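(* For a $K$-user SISO interference channel, the maximum achievable SpAC (per transmitter) is $1$ with probability one, and this is achieved as the number of dimensions used for transmission tends to infinity. That is, the SpAC of a transmitter never exceeds $1$ and, with probability one over the channels, there are symbol extension factors $M\to\infty$ and precoders over $M$ dimensions that achieve SpAC values $n_1/M,\dots,n_K/M$ without an error floor, with $n_j/M\to1$ for every $j=1,\dots,K$.
   Context: System: each node has a single antenna, and precoding is done over $M$ channel uses (symbol extension factor $M$, which is the number of dimensions used for transmission). Receiver $i\in\{1,\dots,K\}$ observes $\mathbf{y}_i=\sum_{j=1}^K\mathbf{H}_{i,j}\mathbf{Q}_j\mathbf{x}_j+\mathbf{z}_i$, where $\mathbf{z}_i$ is zero-mean white Gaussian noise with covariance $\sigma^2\mathbf{I}_M$, and $\mathbf{H}_{i,j}$ is an $M\times M$ complex diagonal matrix. All diagonal entries of all channel matrices are independent, identically and continuously distributed (so each $\mathbf{H}_{i,j}$ is nonsingular almost surely). $\mathbf{Q}_j$ is the $M\times n_j$ precoder of transmitter $j$, of full column rank, and may depend on all channel matrices. $\mathbf{x}_j$ is an $n_j\times1$ symbol vector ($n_j\ge1$) from a finite set $\mathcal{X}_j$ (finite alphabet signaling). SpAC (Symbols per transmit-Antenna per Channel use) of transmitter $j$: the number of symbol streams per available transmit dimension, $n_j/M$. Detection: receiver $i$ uses the minimum distance (MD) detector, which decodes only the desired signal and without co-operation between receivers, $\hat{\mathbf{x}}_i=\arg\min_{\mathbf{x}\in\mathcal{X}_i}(\mathbf{y}_i-\mathbf{H}_{i,i}\mathbf{Q}_i\mathbf{x})^{\mathrm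 H}\mathbf{R}_i^{-1}(\mathbf{y}_i-\mathbf{H}_{i,i}\mathbf{Q}_i\mathbf{x})$ with $\mathbf{R}_i=\sigma^2\mathbf{I}_M+\sum_{j\ne i}\mathbf{H}_{i,j}\mathbf{Q}_j\mathbf{Q}_j^{\mathrm H}\mathbf{H}_{i,j}^{\mathrm H}$. In all error-rate statements the interference plus noise at receiver $i$ is modeled as zero-mean colored Gaussian with covariance $\mathbf{R}_i$. Fractional Interference Alignment (FIA) constraint: with $\mathcal{S}_i=\operatorname{span}(\mathbf{H}_{i,i}\mathbf{Q}_i)$ (column space) and $\mathcal{I}_i$ the subspace spanned by the columns of all $\mathbf{H}_{i,j}\mathbf{Q}_j$, $j\neq i$, one requires $\mathcal{S}_i\nsubseteq\mathcal{I}_i$ for all $i$, in the form $\dim\mathcal{I}_i<M$ and $\dim(\mathcal{S}_i+\mathcal{I}_i)=M$. SpAC values $(n_1/M,\dots,n_K/M)$ are achieved without an error floor by precoders $\mathbf{Q}_j$ of size $M\times n_j$ if these satisfy the FIA constraint at every receiver and the BER of the MD detector at every receiver tends to $0$ as $\sigma^2\to0$. *)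

theory Defs
  imports
    "HOL-Probability.Probability"
    "Jordan_Normal_Form.Gauss_Jordan_Elimination"
    "Jordan_Normal_Form.Schur_Decomposition"
    "Jordan_Normal_Form.DL_Rank"
begin

text \<open>
  Users are numbered \<open>0, \<dots>, K - 1\<close>.  Throughout, \<open>M\<close> is the symbol extension factor,
  \<open>H i j\<close> is the channel matrix from transmitter \<open>j\<close> to receiver \<open>i\<close>, \<open>Q j\<close> is the precoder
  of transmitter \<open>j\<close>, \<open>n j\<close> its number of symbol streams, and \<open>s\<close> is the noise variance
  \<open>\<sigma>\<^sup>2\<close>.
\<close>

definition SpAC :: "nat \<Rightarrow> nat \<Rightarrow> real" where
  "SpAC M m = real m / real M"

definition valid_precoders ::
    "nat \<Rightarrow> nat \<Rightarrow> (nat \<Rightarrow> nat) \<Rightarrow> (nat \<Rightarrow> complex mat) \<Rightarrow> bool" where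
  "valid_precoders K M n Q \<longleftrightarrow>
     (\<forall>j<K. 1 \<le> n j \<and> Q j \<in> carrier_mat M (n j) \<and> vec_space.rank M (Q j) = n j)"

definition cspan :: "nat \<Rightarrow> complex vec set \<Rightarrow> complex vec set" where
  "cspan M B = LinearCombinations.module.span class_ring (module_vec TYPE(complex) M) B"

definition cdim :: "nat \<Rightarrow> complex vec set \<Rightarrow> nat" where
  "cdim M W = vectorspace.dim (class_ring :: complex ring)
                ((module_vec TYPE(complex) M)\<lparr>carrier := W\<rparr>)"

definition signal_space ::
    "nat \<Rightarrow> (nat \<Rightarrow> nat \<Rightarrow> complex mat) \<Rightarrow> (nat \<Rightarrow> complex mat) \<Rightarrow> nat \<Rightarrow> complex vec set" where
  "signal_space M H Q i = cspan M (set (cols (H i i * Q i)))"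

definition interference_space ::
    "nat \<Rightarrow> nat \<Rightarrow> (nat \<Rightarrow> nat \<Rightarrow> complex mat) \<Rightarrow> (nat \<Rightarrow> complex mat) \<Rightarrow> nat \<Rightarrow> complex vec set" where
  "interference_space K M H Q i =
     cspan M (\<Union>j\<in>{..<K} - {i}. set (cols (H i j * Q j)))"

definition FIA ::
    "nat \<Rightarrow> nat \<Rightarrow> (nat \<Rightarrow> nat \<Rightarrow> complex mat) \<Rightarrow> (nat \<Rightarrow> complex mat) \<Rightarrow> bool" where
  "FIA K M H Q \<longleftrightarrow>
     (\<forall>i<K. cdim M (interference_space K M H Q i) < M \<and>
            cdim M {u + v | u v. u \<in> signal_space M H Q i \<and> v \<in> interference_space K M H Q i} = M)"

definition noise_cov ::
    "nat \<Rightarrow> nat \<Rightarrow> (nat \<Rightarrow> nat \<Rightarrow> complex mat) \<Rightarrow> (nat \<Rightarrow> complex mat) \<Rightarrow> nat \<Rightarrow> real \<Rightarrow> complex mat" where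
  "noise_cov K M H Q i s =
     complex_of_real s \<cdot>\<^sub>m 1\<^sub>m M +
     Matrix.mat M M (\<lambda>(a, b). \<Sum>j\<in>{..<K} - {i}.
       (H i j * Q j * mat_adjoint (Q j) * mat_adjoint (H i j)) $$ (a, b))"

text \<open>
  \<open>cquad R v\<close> is \<open>v\<^sup>H R\<^sup>-\<^sup>1 v\<close>, which is real for Hermitian invertible \<open>R\<close>; the operation
  \<open>\<bullet>c\<close> conjugates its second argument.
\<close>

definition cquad :: "complex mat \<Rightarrow> complex vec \<Rightarrow> real" where
  "cquad R v = Re ((the (mat_inverse R) *\<^sub>v v) \<bullet>c v)"

text \<open>
  The circularly symmetric zero-mean Gaussian law on \<open>\<complex>\<^sup>M\<close> with positive definite covariance
  \<open>R\<close>: its density with respect to Lebesgue measure is \<open>exp (- w\<^sup>H R\<^sup>-\<^sup>1 w)\<close>, normalised to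
  total mass one.  Without a factor 1/2 in the exponent, each complex component has variance equal
  to the corresponding diagonal entry of \<open>R\<close> (half of it in each of the real and imaginary parts).
\<close>

definition cgaussian :: "nat \<Rightarrow> complex mat \<Rightarrow> (nat \<Rightarrow> complex) measure" where
  "cgaussian M R =
     (let L = Pi\<^sub>M {..<M} (\<lambda>_. lborel :: complex measure);
          f = (\<lambda>w. ennreal (exp (- cquad R (Matrix.vec M w))))
      in density L (\<lambda>w. f w / (\<integral>\<^sup>+ v. f v \<partial>L)))"

text \<open>
  Minimum distance detection with effective channel \<open>A = H i i * Q i\<close>; ties are resolved by a
  fixed choice from the set of minimisers.
\<close>

definition md_detect ::
    "complex mat \<Rightarrow> complex mat \<Rightarrow> complex vec set \<Rightarrow> complex vec \<Rightarrow> complex vec" where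
  "md_detect A R X y = arg_min_on (\<lambda>x. cquad R (y - A *\<^sub>v x)) X"

text \<open>A finite alphabet of \<open>m\<close>-dimensional symbol vectors whose elements carry distinct bit
  strings of a common length.\<close>

definition labelled_alphabet ::
    "nat \<Rightarrow> complex vec set \<Rightarrow> (complex vec \<Rightarrow> bool list) \<Rightarrow> bool" where
  "labelled_alphabet m X lab \<longleftrightarrow>
     finite X \<and> X \<noteq> {} \<and> X \<subseteq> carrier_vec m \<and> inj_on lab X \<and>
     (\<exists>b. \<forall>x\<in>X. length (lab x) = b)"

definition bit_error_fraction :: "bool list \<Rightarrow> bool list \<Rightarrow> real" where
  "bit_error_fraction u v =
     real (card {k. k < length u \<and> u ! k \<noteq> v ! k}) / real (length u)"

text \<open>Bit error rate for equiprobable symbol vectors and Gaussian interference plus noise.\<close>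

definition BER ::
    "nat \<Rightarrow> complex mat \<Rightarrow> complex mat \<Rightarrow> complex vec set \<Rightarrow> (complex vec \<Rightarrow> bool list) \<Rightarrow> real" where
  "BER M A R X lab =
     (\<Sum>x\<in>X. \<integral>w. bit_error_fraction (lab x)
                    (lab (md_detect A R X (A *\<^sub>v x + Matrix.vec M w))) \<partial>cgaussian M R)
     / real (card X)"

text \<open>
  The precoders \<open>Q\<close> achieve the SpAC values \<open>SpAC M (n j)\<close> without an error floor.  The alphabet
  \<open>X j m\<close> with bit labelling \<open>lab j m\<close> is the one transmitter \<open>j\<close> uses when it sends \<open>m\<close>
  symbol streams.
\<close>

definition achieves_without_floor ::
    "nat \<Rightarrow> nat \<Rightarrow> (nat \<Rightarrow> nat \<Rightarrow> complex mat) \<Rightarrow> (nat \<Rightarrow> nat \<Rightarrow> complex vec set) \<Rightarrow>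
     (nat \<Rightarrow> nat \<Rightarrow> complex vec \<Rightarrow> bool list) \<Rightarrow> (nat \<Rightarrow> nat) \<Rightarrow> (nat \<Rightarrow> complex mat) \<Rightarrow> bool" where
  "achieves_without_floor K M H X lab n Q \<longleftrightarrow>
     valid_precoders K M n Q \<and> FIA K M H Q \<and>
     (\<forall>i<K. ((\<lambda>s. BER M (H i i * Q i) (noise_cov K M H Q i s) (X i (n i)) (lab i (n i)))
               \<longlongrightarrow> 0) (at_right 0))"

end

theory Submission
  imports Defs "HOL-Real_Asymp.Real_Asymp"
begin

text \<open>
  With \<open>M = l + K\<close> channel uses, reserve slot \<open>i < K\<close> for transmitter \<open>i\<close> and let everybody use the
  remaining \<open>l\<close> slots.  Each transmitter then sends \<open>l + 1\<close> streams.  At receiver \<open>i\<close> the interference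
  vanishes in slot \<open>i\<close>, while signal and interference together fill \<open>\<complex>\<^sup>M\<close> as soon as all channel
  coefficients are nonzero, which is the only almost sure property needed.

  All of a transmitter's symbols are superposed in its own slot, with weights chosen so that any two
  alphabet points differ there.  The covariance decouples in that slot, where only the
  noise \<open>s = \<sigma>\<^sup>2\<close> remains, so the squared Mahalanobis distance between two received points is at least
  a positive constant divided by \<open>s\<close>.  The Bhattacharyya bound \<open>exp (- d\<^sup>2 / 4)\<close> for the pairwise error
  probability at Mahalanobis distance \<open>d\<close> then sends the bit error rate to zero.
\<close>

unbundle no vec_syntax

subsection \<open>Error probability of minimum distance detection\<close>

lemma mat_adjoint_index:
  assumes "A \<in> carrier_mat r c" "i < c" "j < r"
  shows "mat_adjoint A $$ (i, j) = conjugate (A $$ (j, i))"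
  using assms by (simp add: mat_adjoint_def mat_of_rows_def)

lemma mat_adjoint_carrier:
  assumes "A \<in> carrier_mat r c"
  shows "mat_adjoint A \<in> carrier_mat c r"
  using assms by (simp add: mat_adjoint_def mat_of_rows_def)

lemma inner_mult_mat_vec:
  fixes B :: "complex mat"
  assumes "B \<in> carrier_mat M M"
  shows "(B *\<^sub>v Matrix.vec M f) \<bullet>c Matrix.vec M f
    = (\<Sum>a<M. \<Sum>b<M. B $$ (a, b) * f b * cnj (f a))"
  using assms
  by (simp add: scalar_prod_def atLeast0LessThan sum_distrib_right sum_distrib_left ac_simps)

lemma cquad_vec:
  assumes "mat_inverse R = Some B" "B \<in> carrier_mat M M"
  shows "cquad R (Matrix.vec M f) = Re (\<Sum>a<M. \<Sum>b<M. B $$ (a, b) * f b * cnj (f a))"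
  using assms by (simp add: cquad_def inner_mult_mat_vec)

text \<open>Expand around the midpoint \<open>w + d / 2\<close>: the cross terms from the two
  endpoints \<open>w\<close> and \<open>w + d\<close> cancel. This rewrites a product of two
  Gaussian densities as one density centred between them.\<close>

lemma cquad_parallelogram:
  assumes "mat_inverse R = Some B" "B \<in> carrier_mat M M"
  shows "cquad R (Matrix.vec M w) + cquad R (Matrix.vec M (\<lambda>a. w a + d a))
    = 2 * cquad R (Matrix.vec M (\<lambda>a. w a + d a / 2)) + cquad R (Matrix.vec M d) / 2"
proof -
  have *: "B $$ (a, b) * w b * cnj (w a) + B $$ (a, b) * (w b + d b) * cnj (w a + d a)
    = 2 * (B $$ (a, b) * (w b + d b / 2) * cnj (w a + d a / 2)) + B $$ (a, b) * d b * cnj (d a) / 2" for a b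
    by (simp add: field_simps)
  have "(\<Sum>a<M. \<Sum>b<M. B $$ (a, b) * w b * cnj (w a)) + (\<Sum>a<M. \<Sum>b<M. B $$ (a, b) * (w b + d b) * cnj (w a + d a))
     = 2 * (\<Sum>a<M. \<Sum>b<M. (B $$ (a, b) * (w b + d b / 2) * cnj (w a + d a / 2))) + (\<Sum>a<M. \<Sum>b<M. B $$ (a, b) * d b * cnj (d a)) / 2"
    by (simp only: sum.distrib[symmetric] sum_distrib_left sum_divide_distrib *)
  from arg_cong[OF this, of Re] show ?thesis
    by (simp only: cquad_vec[OF assms] plus_complex.sel) (simp del: Re_sum)
qed

lemma cquad_measurable:
  assumes "mat_inverse R = Some B" "B \<in> carrier_mat M M"
  shows "(\<lambda>w. cquad R (Matrix.vec M w)) \<in> borel_measurable (Pi\<^sub>M {..<M} (\<lambda>_. lborel :: complex measure))"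
proof -
  have [measurable]: "(\<lambda>w. w a) \<in> borel_measurable (Pi\<^sub>M {..<M} (\<lambda>_. lborel :: complex measure))" if "a \<in> {..<M}" for a
    using measurable_component_singleton[OF that, of "\<lambda>_. lborel :: complex measure"] by simp
  have [measurable]: "cnj \<in> borel_measurable borel"
    by (intro borel_measurable_continuous_onI continuous_intros)
  show ?thesis
    unfolding cquad_vec[OF assms] by measurable
qed

section \<open>Translation invariance and the Bhattacharyya bound\<close>

lemma nn_integral_PiM_lborel_translate:
  fixes d :: "'i \<Rightarrow> 'a::euclidean_space"
  assumes I: "finite I" and F: "F \<in> borel_measurable (Pi\<^sub>M I (\<lambda>_. lborel))"
  shows "(\<integral>\<^sup>+ w. F (\<lambda>i\<in>I. w i + d i) \<partial>Pi\<^sub>M I (\<lambda>_. lborel)) = (\<integral>\<^sup>+ w. F w \<partial>Pi\<^sub>M I (\<lambda>_. lborel))"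
proof -
  let ?L = "Pi\<^sub>M I (\<lambda>_. lborel :: 'a measure)"
  let ?T = "\<lambda>w. \<lambda>i\<in>I. w i + d i"
  interpret product_sigma_finite "\<lambda>_. lborel :: 'a measure"
    by unfold_locales
  have T: "?T \<in> measurable ?L ?L"
    by (rule measurable_restrict) (measurable)
  \<comment> \<open>A product measure is determined by its values on boxes, and translation
    preserves the Lebesgue measure of each side. Restricting to \<open>I\<close> keeps the shifted
    point extensional, hence inside the space of \<open>?L\<close>.\<close>
  have "distr ?L ?L ?T = ?L"
  proof (rule PiM_eqI[OF I])
    fix A :: "'i \<Rightarrow> 'a set" assume A: "\<And>i. i \<in> I \<Longrightarrow> A i \<in> sets lborel"
    have vimage: "(\<lambda>x. d i + x) -` A i \<in> sets lborel" if "i \<in> I" for i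
    proof -
      have "(\<lambda>x. d i + x) -` A i \<inter> space borel \<in> sets borel"
        using A[OF that] by (intro measurable_sets[of _ _ borel]) auto
      then show ?thesis by simp
    qed
    have eq: "?T -` Pi\<^sub>E I A \<inter> space ?L = Pi\<^sub>E I (\<lambda>i. (\<lambda>x. d i + x) -` A i)"
      by (auto simp: space_PiM PiE_iff add.commute extensional_def)
    have "emeasure (distr ?L ?L ?T) (Pi\<^sub>E I A) = emeasure ?L (?T -` Pi\<^sub>E I A \<inter> space ?L)"
      using A I by (intro emeasure_distr[OF T] sets_PiM_I_finite) auto
    also have "\<dots> = (\<Prod>i\<in>I. emeasure lborel ((\<lambda>x. d i + x) -` A i))"
      unfolding eq using vimage by (intro emeasure_PiM I)
    also have "\<dots> = (\<Prod>i\<in>I. emeasure lborel (A i))"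
    proof (rule prod.cong[OF refl])
      fix i assume "i \<in> I"
      then have "A i \<in> sets borel" using A by simp
      then have "emeasure (distr lborel borel ((+) (d i))) (A i) = emeasure lborel ((\<lambda>x. d i + x) -` A i)"
        by (subst emeasure_distr) auto
      then show "emeasure lborel ((\<lambda>x. d i + x) -` A i) = emeasure lborel (A i)"
        by (simp add: lborel_distr_plus)
    qed
    finally show "emeasure (distr ?L ?L ?T) (Pi\<^sub>E I A) = (\<Prod>i\<in>I. emeasure lborel (A i))" .
  qed simp
  then show ?thesis
    using nn_integral_distr[OF T, of F] F by simp
qed

lemma cquad_translate_measurable:
  assumes "mat_inverse R = Some B" "B \<in> carrier_mat M M"
  shows "(\<lambda>w. cquad R (Matrix.vec M (\<lambda>a. w a + d a)))
    \<in> borel_measurable (Pi\<^sub>M {..<M} (\<lambda>_. lborel :: complex measure))"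
proof -
  let ?L = "Pi\<^sub>M {..<M} (\<lambda>_. lborel :: complex measure)"
  have "(\<lambda>w. \<lambda>i\<in>{..<M}. w i + d i) \<in> measurable ?L ?L"
    by (rule measurable_restrict) (measurable)
  from measurable_compose[OF this cquad_measurable[OF assms]]
  have "(\<lambda>w. cquad R (Matrix.vec M (\<lambda>i\<in>{..<M}. w i + d i))) \<in> borel_measurable ?L" .
  \<comment> \<open>\<open>Matrix.vec M\<close> reads only the indices below \<open>M\<close>, so
    the restricted and the unrestricted shift give the same vector.\<close>
  moreover have "Matrix.vec M (\<lambda>i\<in>{..<M}. w i + d i) = Matrix.vec M (\<lambda>a. w a + d a)" for w
    by (auto intro!: eq_vecI)
  ultimately show ?thesis by simp
qed

text \<open>With unnormalised density \<open>f = exp (- q)\<close>, the integrand is the geometric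
  mean of \<open>f w\<close> and \<open>f (w + d)\<close>. By the parallelogram law this is
  \<open>exp (- q d / 4)\<close> times \<open>f (w + d / 2)\<close>, and translation invariance
  integrates the latter to the normalising constant \<open>Z\<close>.\<close>

lemma cgaussian_pairwise_error:
  assumes R: "mat_inverse R = Some B" "B \<in> carrier_mat M M"
  shows "(\<integral>\<^sup>+ w. ennreal (exp ((cquad R (Matrix.vec M w) - cquad R (Matrix.vec M (\<lambda>a. w a + d a))) / 2))
      \<partial>cgaussian M R) \<le> ennreal (exp (- cquad R (Matrix.vec M d) / 4))"
proof -
  let ?L = "Pi\<^sub>M {..<M} (\<lambda>_. lborel :: complex measure)"
  define q where "q w = cquad R (Matrix.vec M w)" for w
  define f where "f w = ennreal (exp (- q w))" for w
  define Z where "Z = (\<integral>\<^sup>+ w. f w \<partial>?L)"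
  have q [measurable]: "q \<in> borel_measurable ?L"
    unfolding q_def by (rule cquad_measurable[OF R])
  then have f [measurable]: "f \<in> borel_measurable ?L"
    unfolding f_def by measurable
  have q_shift: "q (\<lambda>i\<in>{..<M}. w i + e i) = q (\<lambda>i. w i + e i)" for w e
    unfolding q_def by (rule arg_cong[where f = "cquad R"]) (auto intro!: eq_vecI)
  have shift: "(\<lambda>w. \<lambda>i\<in>{..<M}. w i + e i) \<in> measurable ?L ?L" for e
    by (rule measurable_restrict) (measurable)
  have qs [measurable]: "(\<lambda>w. q (\<lambda>i. w i + e i)) \<in> borel_measurable ?L" for e
    unfolding q_def by (rule cquad_translate_measurable[OF R])
  have par: "q w + q (\<lambda>a. w a + d a) = 2 * q (\<lambda>a. w a + d a / 2) + q d / 2" for w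
    unfolding q_def by (rule cquad_parallelogram[OF R])
  have "(\<integral>\<^sup>+ w. ennreal (exp ((q w - q (\<lambda>a. w a + d a)) / 2)) \<partial>cgaussian M R)
      = (\<integral>\<^sup>+ w. f w / Z * ennreal (exp ((q w - q (\<lambda>a. w a + d a)) / 2)) \<partial>?L)"
    unfolding cgaussian_def Let_def f_def[symmetric] Z_def[symmetric] q_def[symmetric]
    by (rule nn_integral_density) (measurable)
  also have "\<dots> = (\<integral>\<^sup>+ w. ennreal (exp (- q d / 4)) / Z * f (\<lambda>i\<in>{..<M}. w i + d i / 2) \<partial>?L)"
  proof (rule nn_integral_cong)
    fix w
    have "f w * ennreal (exp ((q w - q (\<lambda>a. w a + d a)) / 2))
      = ennreal (exp (- q d / 4)) * f (\<lambda>i\<in>{..<M}. w i + d i / 2)"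
    proof -
      have e: "- q w + (q w - q (\<lambda>a. w a + d a)) / 2 = - q d / 4 + - q (\<lambda>i. w i + d i / 2)"
        using par[of w] by (simp add: field_simps)
      show ?thesis
        unfolding f_def q_shift by (simp only: ennreal_mult[symmetric] exp_ge_zero exp_add[symmetric] e)
    qed
    then show "f w / Z * ennreal (exp ((q w - q (\<lambda>a. w a + d a)) / 2))
      = ennreal (exp (- q d / 4)) / Z * f (\<lambda>i\<in>{..<M}. w i + d i / 2)"
      by (simp add: divide_ennreal_def ac_simps)
  qed
  also have "\<dots> = ennreal (exp (- q d / 4)) / Z * (\<integral>\<^sup>+ w. f (\<lambda>i\<in>{..<M}. w i + d i / 2) \<partial>?L)"
    by (rule nn_integral_cmult) (rule measurable_compose[OF shift f])
  also have "(\<integral>\<^sup>+ w. f (\<lambda>i\<in>{..<M}. w i + d i / 2) \<partial>?L) = Z"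
    unfolding Z_def by (rule nn_integral_PiM_lborel_translate[OF _ f]) simp
  also have "ennreal (exp (- q d / 4)) / Z * Z = ennreal (exp (- q d / 4)) * (Z / Z)"
    by (simp add: divide_ennreal_def ac_simps)
  also have "\<dots> \<le> ennreal (exp (- q d / 4)) * 1"
  proof (rule mult_left_mono)
    \<comment> \<open>In \<^typ>\<open>ennreal\<close>, \<open>0 / 0 = \<infinity> / \<infinity> = 0\<close>, so \<open>Z\<close> need not be computed.\<close>
    show "Z / Z \<le> 1"
      by (cases "Z = 0 \<or> Z = \<top>") (auto simp: ennreal_divide_self less_top[symmetric])
  qed simp
  finally show ?thesis by (simp add: q_def)
qed

section \<open>Union bound for the bit error rate\<close>

lemma bit_error_fraction_le_1: "bit_error_fraction u v \<le> 1"
proof -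
  have "card {k. k < length u \<and> u ! k \<noteq> v ! k} \<le> card {..<length u}"
    by (rule card_mono) auto
  then show ?thesis by (simp add: bit_error_fraction_def divide_le_eq_1)
qed

lemma bit_error_fraction_same: "bit_error_fraction u u = 0"
  by (simp add: bit_error_fraction_def)

lemma bit_error_fraction_nonneg: "0 \<le> bit_error_fraction u v"
  by (simp add: bit_error_fraction_def)

lemma BER_nonneg: "0 \<le> BER M A R X lab"
  unfolding BER_def
  by (intro divide_nonneg_nonneg sum_nonneg Bochner_Integration.integral_nonneg bit_error_fraction_nonneg) simp_all

text \<open>A pointwise union bound. If the detector picks a wrong \<open>x'\<close>, its residual
  is no larger than that of \<open>x\<close>, so the exponential belonging to \<open>x'\<close> is
  at least 1 and dominates the error fraction. If it picks \<open>x\<close>, the left side is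
  0.\<close>

lemma bit_error_fraction_md_detect_le:
  fixes w :: "nat \<Rightarrow> complex"
  assumes X: "finite X" "X \<subseteq> carrier_vec n" and A: "A \<in> carrier_mat M n" and x: "x \<in> X"
  defines "d \<equiv> \<lambda>x' a. vec_index (A *\<^sub>v x - A *\<^sub>v x') a"
  shows "bit_error_fraction (lab x) (lab (md_detect A R X (A *\<^sub>v x + Matrix.vec M w)))
    \<le> (\<Sum>x'\<in>X - {x}. exp ((cquad R (Matrix.vec M w) - cquad R (Matrix.vec M (\<lambda>a. w a + d x' a))) / 2))"
proof -
  define y where "y = A *\<^sub>v x + Matrix.vec M w"
  define x' where "x' = md_detect A R X y"
  let ?h = "\<lambda>x. cquad R (y - A *\<^sub>v x)"
  have x': "x' \<in> X" "?h x' \<le> ?h x"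
    using arg_min_if_finite[of X ?h] X x unfolding x'_def md_detect_def by (auto simp: not_less)
  have [simp]: "dim_row A = M" using A by simp
  have hx: "y - A *\<^sub>v x = Matrix.vec M w"
    unfolding y_def by (auto intro!: eq_vecI)
  have hx': "y - A *\<^sub>v x' = Matrix.vec M (\<lambda>a. w a + d x' a)"
    unfolding y_def d_def by (auto intro!: eq_vecI)
  show ?thesis
  proof (cases "x' = x")
    case True
    then show ?thesis
      by (simp add: x'_def[symmetric] y_def[symmetric] bit_error_fraction_same sum_nonneg)
  next
    case False
    have "1 \<le> exp ((cquad R (Matrix.vec M w) - cquad R (Matrix.vec M (\<lambda>a. w a + d x' a))) / 2)"
      using x'(2) unfolding hx hx' by simp
    also have "\<dots> \<le> (\<Sum>x'\<in>X - {x}. exp ((cquad R (Matrix.vec M w) - cquad R (Matrix.vec M (\<lambda>a. w a + d x' a))) / 2))"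
      using False x' X by (intro member_le_sum) auto
    finally show ?thesis
      using bit_error_fraction_le_1 order_trans by blast
  qed
qed

text \<open>Integrating the pointwise union bound turns each exponential into a Bhattacharyya
  factor.\<close>

lemma BER_le:
  assumes R: "mat_inverse R = Some B" "B \<in> carrier_mat M M"
    and X: "finite X" "X \<subseteq> carrier_vec n" and A: "A \<in> carrier_mat M n"
  shows "BER M A R X lab \<le> (\<Sum>x\<in>X. \<Sum>x'\<in>X - {x}. exp (- cquad R (A *\<^sub>v x - A *\<^sub>v x') / 4)) / real (card X)"
proof -
  have "(\<integral>w. bit_error_fraction (lab x) (lab (md_detect A R X (A *\<^sub>v x + Matrix.vec M w))) \<partial>cgaussian M R)
     \<le> (\<Sum>x'\<in>X - {x}. exp (- cquad R (A *\<^sub>v x - A *\<^sub>v x') / 4))" (is "(\<integral>w. ?g w \<partial>_) \<le> ?S") if x: "x \<in> X" for x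
  proof (cases "integrable (cgaussian M R) ?g")
    \<comment> \<open>A Bochner integral that does not exist has value 0, so measurability of the
      detector never has to be shown.\<close>
    case False
    then show ?thesis by (simp add: not_integrable_integral_eq sum_nonneg)
  next
    case True
    define d where "d x' a = vec_index (A *\<^sub>v x - A *\<^sub>v x') a" for x' a
    have [simp]: "dim_row A = M" using A by simp
    have d: "Matrix.vec M (d x') = A *\<^sub>v x - A *\<^sub>v x'" for x'
      unfolding d_def by (auto intro!: eq_vecI)
    let ?L = "Pi\<^sub>M {..<M} (\<lambda>_. lborel :: complex measure)"
    let ?E = "\<lambda>x' w. exp ((cquad R (Matrix.vec M w) - cquad R (Matrix.vec M (\<lambda>a. w a + d x' a))) / 2)"
    have [measurable]: "(\<lambda>w. cquad R (Matrix.vec M w)) \<in> borel_measurable ?L"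
      by (rule cquad_measurable[OF R])
    have [measurable]: "(\<lambda>w. cquad R (Matrix.vec M (\<lambda>a. w a + d x' a))) \<in> borel_measurable ?L" for x'
      by (rule cquad_translate_measurable[OF R])
    \<comment> \<open>A density has the same measurable sets as its base measure
      \<open>?L\<close>.\<close>
    have sets: "measurable (cgaussian M R) N = measurable ?L N" for N :: "ennreal measure"
      by (rule measurable_cong_sets) (simp_all add: cgaussian_def Let_def)
    have "(\<integral>\<^sup>+ w. ennreal (?g w) \<partial>cgaussian M R) \<le> (\<integral>\<^sup>+ w. (\<Sum>x'\<in>X - {x}. ennreal (?E x' w)) \<partial>cgaussian M R)"
      using bit_error_fraction_md_detect_le[OF X A x, of lab R]
      by (intro nn_integral_mono) (simp add: d_def[symmetric] sum_ennreal ennreal_leI)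
    also have "\<dots> = (\<Sum>x'\<in>X - {x}. \<integral>\<^sup>+ w. ennreal (?E x' w) \<partial>cgaussian M R)"
      by (rule nn_integral_sum) (unfold sets, measurable)
    also have "\<dots> \<le> (\<Sum>x'\<in>X - {x}. ennreal (exp (- cquad R (A *\<^sub>v x - A *\<^sub>v x') / 4)))"
      by (intro sum_mono) (use cgaussian_pairwise_error[OF R] in \<open>simp add: d[symmetric]\<close>)
    also have "\<dots> = ennreal ?S"
      by (rule sum_ennreal) simp
    finally have "(\<integral>\<^sup>+ w. ennreal (?g w) \<partial>cgaussian M R) \<le> ennreal ?S" .
    moreover have "(\<integral>\<^sup>+ w. ennreal (?g w) \<partial>cgaussian M R) = ennreal (\<integral>w. ?g w \<partial>cgaussian M R)"
      using True by (rule nn_integral_eq_integral) (simp add: bit_error_fraction_nonneg)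
    ultimately show ?thesis
      by (simp add: ennreal_le_iff sum_nonneg)
  qed
  then show ?thesis
    unfolding BER_def by (intro divide_right_mono sum_mono) auto
qed

section \<open>The covariance of interference plus noise\<close>

lemma mult_adjoint_index:
  assumes H: "H \<in> carrier_mat M M" and Q: "Q \<in> carrier_mat M n" and ab: "a < M" "b < M"
  shows "(H * Q * mat_adjoint Q * mat_adjoint H) $$ (a, b)
    = (\<Sum>k<n. (H * Q) $$ (a, k) * cnj ((H * Q) $$ (b, k)))"
proof -
  note adj = mat_adjoint_carrier[OF H] mat_adjoint_carrier[OF Q]
  have "H * Q * mat_adjoint Q * mat_adjoint H = (H * Q) * (mat_adjoint Q * mat_adjoint H)"
    using H Q adj by (intro assoc_mult_mat[of _ M n _ M _ M]) auto
  moreover have "(mat_adjoint Q * mat_adjoint H) $$ (k, b) = cnj ((H * Q) $$ (b, k))" if "k < n" for k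
    using H Q adj ab that
    by (simp add: scalar_prod_def mat_adjoint_index[OF H] mat_adjoint_index[OF Q] mult.commute)
  moreover have "((H * Q) * (mat_adjoint Q * mat_adjoint H)) $$ (a, b)
      = (\<Sum>k<n. (H * Q) $$ (a, k) * (mat_adjoint Q * mat_adjoint H) $$ (k, b))"
    using H Q adj ab by (simp add: scalar_prod_def atLeast0LessThan)
  ultimately show ?thesis by simp
qed

lemma noise_cov_index:
  assumes H: "\<And>j. j < K \<Longrightarrow> H i j \<in> carrier_mat M M" and Q: "\<And>j. j < K \<Longrightarrow> Q j \<in> carrier_mat M (n j)"
    and ab: "a < M" "b < M"
  shows "noise_cov K M H Q i s $$ (a, b) = (if a = b then complex_of_real s else 0)
    + (\<Sum>j\<in>{..<K} - {i}. \<Sum>k<n j. (H i j * Q j) $$ (a, k) * cnj ((H i j * Q j) $$ (b, k)))"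
  using ab by (simp add: noise_cov_def mult_adjoint_index[OF H Q])

lemma noise_cov_carrier: "noise_cov K M H Q i s \<in> carrier_mat M M"
  by (simp add: noise_cov_def)

context
  fixes R :: "complex mat" and M :: nat and s :: real
    and J :: "'j set" and m :: "'j \<Rightarrow> nat" and g :: "'j \<Rightarrow> nat \<Rightarrow> nat \<Rightarrow> complex"
  assumes R: "R \<in> carrier_mat M M"
    and R_index: "\<And>a b. a < M \<Longrightarrow> b < M \<Longrightarrow>
      R $$ (a, b) = (if a = b then complex_of_real s else 0) + (\<Sum>j\<in>J. \<Sum>k<m j. g j a k * cnj (g j b k))"
    and s: "0 < s"
begin

text \<open>Each interfering column contributes a rank-one positive semidefinite term, whose
  quadratic form is a squared modulus. Dropping these terms leaves the white noise part.\<close>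

lemma covariance_inner_ge:
  assumes u: "u \<in> carrier_vec M"
  shows "s * (\<Sum>a<M. (cmod (u $ a))\<^sup>2) \<le> Re ((R *\<^sub>v u) \<bullet>c u)"
proof -
  have uv: "Matrix.vec M (\<lambda>a. u $ a) = u"
    using u by auto
  have "(R *\<^sub>v u) \<bullet>c u = (\<Sum>a<M. \<Sum>b<M. R $$ (a, b) * u $ b * cnj (u $ a))"
    using inner_mult_mat_vec[OF R, of "\<lambda>a. u $ a"] by (simp add: uv)
  also have "\<dots> = (\<Sum>a<M. \<Sum>b<M. (if a = b then complex_of_real s * u $ b * cnj (u $ a) else 0)
      + (\<Sum>j\<in>J. \<Sum>k<m j. (g j a k * cnj (u $ a)) * cnj (g j b k * cnj (u $ b))))"
  proof (intro sum.cong refl)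
    fix a b assume "a \<in> {..<M}" "b \<in> {..<M}"
    then have ab: "a < M" "b < M" by auto
    have "(\<Sum>j\<in>J. \<Sum>k<m j. (g j a k * cnj (u $ a)) * cnj (g j b k * cnj (u $ b)))
        = (\<Sum>j\<in>J. \<Sum>k<m j. g j a k * cnj (g j b k)) * u $ b * cnj (u $ a)"
      unfolding sum_distrib_right by (intro sum.cong refl) (simp add: ac_simps)
    then show "R $$ (a, b) * u $ b * cnj (u $ a)
        = (if a = b then complex_of_real s * u $ b * cnj (u $ a) else 0)
          + (\<Sum>j\<in>J. \<Sum>k<m j. (g j a k * cnj (u $ a)) * cnj (g j b k * cnj (u $ b)))"
      by (simp only: R_index[OF ab] distrib_right) (cases "a = b"; simp)
  qed
  also have "\<dots> = (\<Sum>a<M. complex_of_real s * u $ a * cnj (u $ a))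
      + (\<Sum>a<M. \<Sum>b<M. \<Sum>j\<in>J. \<Sum>k<m j. (g j a k * cnj (u $ a)) * cnj (g j b k * cnj (u $ b)))"
    by (simp add: sum.distrib)
  \<comment> \<open>With the sums over \<open>j\<close> and \<open>k\<close> moved outside, the sums
    over \<open>a\<close> and \<open>b\<close> factor into a number times its conjugate.\<close>
  also have "(\<Sum>a<M. \<Sum>b<M. \<Sum>j\<in>J. \<Sum>k<m j. (g j a k * cnj (u $ a)) * cnj (g j b k * cnj (u $ b)))
      = (\<Sum>j\<in>J. \<Sum>k<m j. (\<Sum>a<M. g j a k * cnj (u $ a)) * cnj (\<Sum>b<M. g j b k * cnj (u $ b)))"
    unfolding cnj_sum sum_product sum.swap[of _ J "{..<M}"] sum.swap[of _ "{..<m _}" "{..<M}"] ..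
  finally have "Re ((R *\<^sub>v u) \<bullet>c u) = (\<Sum>a<M. s * (cmod (u $ a))\<^sup>2)
      + (\<Sum>j\<in>J. \<Sum>k<m j. (cmod (\<Sum>a<M. g j a k * cnj (u $ a)))\<^sup>2)"
    by (simp only: plus_complex.sel Re_sum mult.assoc complex_norm_square[symmetric] of_real_mult[symmetric] Re_complex_of_real)
  moreover have "0 \<le> (\<Sum>j\<in>J. \<Sum>k<m j. (cmod (\<Sum>a<M. g j a k * cnj (u $ a)))\<^sup>2)"
    by (intro sum_nonneg) simp
  ultimately show ?thesis by (simp add: sum_distrib_left)
qed

text \<open>A nonzero kernel vector would have quadratic form 0, contradicting the positive lower
  bound from the noise.\<close>

lemma covariance_inverse:
  obtains B where "mat_inverse R = Some B" "B \<in> carrier_mat M M" "R * B = 1\<^sub>m M"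
proof (cases "mat_inverse R")
  case None
  then have "det R = 0"
    using mat_inverse(1)[OF R, where b = "()"] det_non_zero_imp_unit[OF R, where b = "()"] by blast
  then obtain u where u: "u \<in> carrier_vec M" "u \<noteq> 0\<^sub>v M" "R *\<^sub>v u = 0\<^sub>v M"
    using det_0_iff_vec_prod_zero_field[OF R] by blast
  have "\<exists>a<M. u $ a \<noteq> 0"
    using u(1,2) eq_vecI[of "0\<^sub>v M" u] by auto
  then obtain a where a: "a < M" "u $ a \<noteq> 0" by blast
  have "0 < (cmod (u $ a))\<^sup>2" using a by simp
  also have "\<dots> \<le> (\<Sum>a<M. (cmod (u $ a))\<^sup>2)"
    using a by (intro member_le_sum) auto
  finally have "0 < s * (\<Sum>a<M. (cmod (u $ a))\<^sup>2)" using s by simp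
  also have "\<dots> \<le> Re ((R *\<^sub>v u) \<bullet>c u)"
    by (rule covariance_inner_ge[OF u(1)])
  finally show ?thesis using u by simp
next
  case (Some B)
  then show ?thesis using mat_inverse(2)[OF R] that by blast
qed

text \<open>Without interference in coordinate \<open>i\<close>, row \<open>i\<close> of
  \<open>R\<close> is \<open>s\<close> times a unit row. For \<open>u\<close> with
  \<open>R u = v\<close> this gives \<open>v $ i = s * u $ i\<close>, while the form at
  \<open>v\<close> equals the inner product of \<open>R u\<close> with \<open>u\<close>, hence is at
  least \<open>s\<close> times the squared modulus of \<open>u $ i\<close>.\<close>

lemma cquad_covariance_ge:
  assumes v: "v \<in> carrier_vec M" and i: "i < M" and g: "\<And>j k. j \<in> J \<Longrightarrow> k < m j \<Longrightarrow> g j i k = 0"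
  shows "(cmod (v $ i))\<^sup>2 / s \<le> cquad R v"
proof -
  obtain B where B: "mat_inverse R = Some B" "B \<in> carrier_mat M M" "R * B = 1\<^sub>m M"
    by (rule covariance_inverse)
  define u where "u = B *\<^sub>v v"
  have u: "u \<in> carrier_vec M" using B(2) v by (simp add: u_def)
  have v_eq: "v = R *\<^sub>v u"
    using B R v by (simp add: u_def assoc_mult_mat_vec[symmetric, of R M M B M v])
  have "v $ i = (\<Sum>b<M. R $$ (i, b) * u $ b)"
    unfolding v_eq using R u i by (simp add: scalar_prod_def atLeast0LessThan)
  also have "\<dots> = (\<Sum>b<M. if i = b then complex_of_real s * u $ b else 0)"
    using i g by (intro sum.cong refl) (simp add: R_index)
  also have "\<dots> = complex_of_real s * u $ i" using i by simp
  finally have "(cmod (v $ i))\<^sup>2 / s = s * (cmod (u $ i))\<^sup>2"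
    using s by (simp add: norm_mult power2_eq_square)
  also have "\<dots> \<le> s * (\<Sum>a<M. (cmod (u $ a))\<^sup>2)"
    using s i by (intro mult_left_mono member_le_sum) auto
  also have "\<dots> \<le> Re (v \<bullet>c u)"
    unfolding v_eq by (rule covariance_inner_ge[OF u])
  also have "\<dots> = Re (u \<bullet>c v)"
    using u v by (simp add: scalar_prod_def mult.commute)
  also have "\<dots> = cquad R v"
    using B by (simp add: cquad_def u_def)
  finally show ?thesis .
qed

end

text \<open>Coordinate \<open>i\<close> is free of interference and separates the alphabet, so every
  Mahalanobis distance squared is at least a positive constant over \<open>s\<close>, and each term
  of the union bound decays like \<open>exp (- c / s)\<close>.\<close>

lemma BER_tendsto_0:
  assumes X: "finite X" "X \<subseteq> carrier_vec n" and A: "A \<in> carrier_mat M n" and i: "i < M"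
    and H: "\<And>j. j < K \<Longrightarrow> H i j \<in> carrier_mat M M" and Q: "\<And>j. j < K \<Longrightarrow> Q j \<in> carrier_mat M (m j)"
    and clean: "\<And>j k. j < K \<Longrightarrow> j \<noteq> i \<Longrightarrow> k < m j \<Longrightarrow> (H i j * Q j) $$ (i, k) = 0"
    and sep: "\<And>x x'. x \<in> X \<Longrightarrow> x' \<in> X \<Longrightarrow> x \<noteq> x' \<Longrightarrow> (A *\<^sub>v x - A *\<^sub>v x') $ i \<noteq> 0"
  shows "((\<lambda>s. BER M A (noise_cov K M H Q i s) X lab) \<longlongrightarrow> 0) (at_right 0)"
proof (rule tendsto_sandwich)
  let ?bound = "\<lambda>s. (\<Sum>x\<in>X. \<Sum>x'\<in>X - {x}. exp (- ((cmod ((A *\<^sub>v x - A *\<^sub>v x') $ i))\<^sup>2 / 4 * inverse s))) / real (card X)"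
  show "eventually (\<lambda>s. 0 \<le> BER M A (noise_cov K M H Q i s) X lab) (at_right 0)"
    by (simp add: BER_nonneg)
  show "eventually (\<lambda>s. BER M A (noise_cov K M H Q i s) X lab \<le> ?bound s) (at_right 0)"
    unfolding eventually_at_right_field
  \<comment> \<open>The radius 1 is arbitrary: the bound holds for every positive
    \<open>s\<close>.\<close>
  proof (intro exI[of _ 1] conjI allI impI)
    fix s :: real assume s: "0 < s"
    have idx: "noise_cov K M H Q i s $$ (a, b) = (if a = b then complex_of_real s else 0)
        + (\<Sum>j\<in>{..<K} - {i}. \<Sum>k<m j. (H i j * Q j) $$ (a, k) * cnj ((H i j * Q j) $$ (b, k)))"
      if "a < M" "b < M" for a b
      using that by (intro noise_cov_index H Q)
    obtain B where B: "mat_inverse (noise_cov K M H Q i s) = Some B" "B \<in> carrier_mat M M"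
      using covariance_inverse[OF noise_cov_carrier idx s] by blast
    have exp_le: "exp (- q / 4) \<le> exp (- (c / 4 * inverse s))" if "c / s \<le> q" for c q :: real
      using that s by (simp add: field_simps)
    have "exp (- cquad (noise_cov K M H Q i s) (A *\<^sub>v x - A *\<^sub>v x') / 4)
        \<le> exp (- ((cmod ((A *\<^sub>v x - A *\<^sub>v x') $ i))\<^sup>2 / 4 * inverse s))"
      if "x \<in> X" "x' \<in> X" for x x'
    proof -
      have d: "A *\<^sub>v x - A *\<^sub>v x' \<in> carrier_vec M"
        using A X that by (intro minus_carrier_vec mult_mat_vec_carrier) auto
      have "(cmod ((A *\<^sub>v x - A *\<^sub>v x') $ i))\<^sup>2 / s \<le> cquad (noise_cov K M H Q i s) (A *\<^sub>v x - A *\<^sub>v x')"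
      proof (rule cquad_covariance_ge[OF noise_cov_carrier _ s d i])
        show "\<And>a b. a < M \<Longrightarrow> b < M \<Longrightarrow> noise_cov K M H Q i s $$ (a, b) = (if a = b then complex_of_real s else 0)
            + (\<Sum>j\<in>{..<K} - {i}. \<Sum>k<m j. (H i j * Q j) $$ (a, k) * cnj ((H i j * Q j) $$ (b, k)))"
          by (rule idx)
        show "(H i j * Q j) $$ (i, k) = 0" if "j \<in> {..<K} - {i}" "k < m j" for j k
          using that clean by simp
      qed
      then show ?thesis by (rule exp_le)
    qed
    then show "BER M A (noise_cov K M H Q i s) X lab \<le> ?bound s"
      by - (rule order_trans[OF BER_le[OF B X A]], intro divide_right_mono sum_mono, auto)
  qed simp
  have "((\<lambda>s. exp (- (c / 4 * inverse s))) \<longlongrightarrow> 0) (at_right 0)" if "0 < c" for c :: real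
    using that
    by (intro filterlim_compose[OF exp_at_bot] filterlim_compose[OF filterlim_uminus_at_bot_at_top]
        filterlim_tendsto_pos_mult_at_top[OF tendsto_const _ filterlim_inverse_at_top_right]) simp
  then show "(?bound \<longlongrightarrow> 0) (at_right 0)"
    using sep by (intro tendsto_divide_zero tendsto_null_sum) auto
qed simp

subsection \<open>Spans and dimensions in \<open>\<complex>\<^sup>M\<close>\<close>

lemma cspan_index_zero:
  assumes B: "B \<subseteq> carrier_vec M" and i: "i < M" and zero: "\<And>b. b \<in> B \<Longrightarrow> b $ i = 0"
    and v: "v \<in> cspan M B"
  shows "v $ i = 0"
proof -
  interpret V: vec_space "TYPE(complex)" M .
  from v obtain a A where "v = V.lincomb a A" "finite A" "A \<subseteq> B"
    unfolding cspan_def using V.in_spanE by blast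
  then show ?thesis
    using V.lincomb_index[OF i, of A a] B zero by (auto intro!: sum.neutral)
qed

text \<open>The span lies in the hyperplane where coordinate \<open>i\<close> vanishes. Hence a
  maximal independent subset \<open>U\<close> of \<open>B\<close> stays independent after adding the
  unit vector \<open>i\<close>, so \<open>card U + 1 \<le> M\<close>.\<close>

lemma cdim_cspan_less:
  assumes fin: "finite B" and B: "B \<subseteq> carrier_vec M" and i: "i < M"
    and zero: "\<And>b. b \<in> B \<Longrightarrow> b $ i = 0"
  shows "cdim M (cspan M B) < M"
proof -
  interpret V: vec_space "TYPE(complex)" M .
  have "\<exists>U. finite U \<and> maximal U (\<lambda>T. T \<subseteq> B \<and> V.lin_indpt T) \<and> {} \<subseteq> U"
    using fin by (intro maximal_exists_superset[of B]) (auto simp: V.lin_dep_def)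
  then obtain U where U: "finite U" "maximal U (\<lambda>T. T \<subseteq> B \<and> V.lin_indpt T)" by blast
  then have UB: "U \<subseteq> B" and li: "V.lin_indpt U" by (auto simp: maximal_def)
  have dim: "cdim M (cspan M B) = card U"
    unfolding cdim_def cspan_def by (rule V.dim_span) (use fin B U in auto)
  have e: "unit_vec M i \<notin> V.span U"
    using cspan_index_zero[of U M i "unit_vec M i"] UB B i zero by (auto simp: cspan_def)
  have "U \<subseteq> carrier_vec M" using UB B by auto
  then have eU: "unit_vec M i \<notin> U"
    using e V.in_own_span by blast
  have "V.lin_indpt (U \<union> {unit_vec M i})"
    using V.lin_dep_iff_in_span[of U "unit_vec M i"] \<open>U \<subseteq> carrier_vec M\<close> li e eU by auto
  then have "card (U \<union> {unit_vec M i}) \<le> M"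
    using V.li_le_dim(2)[of "U \<union> {unit_vec M i}"] \<open>U \<subseteq> carrier_vec M\<close> V.dim_is_n by auto
  then show ?thesis
    using U(1) eU dim by simp
qed

lemma rank_le_nr:
  fixes A :: "complex mat"
  assumes A: "A \<in> carrier_mat M n"
  shows "vec_space.rank M A \<le> M"
proof -
  interpret V: vec_space "TYPE(complex)" M .
  have "set (cols A) \<subseteq> carrier_vec M" using A cols_dim by blast
  then show ?thesis
    using V.subspace_dim[of "V.span (set (cols A))"] V.fin_dim_span_cols[OF A] V.span_is_subspace
    by (simp add: V.rank_def V.dim_is_n)
qed

lemma rank_eq_nc:
  fixes A :: "complex mat"
  assumes A: "A \<in> carrier_mat M n"
    and inj: "\<And>v. v \<in> carrier_vec n \<Longrightarrow> A *\<^sub>v v = 0\<^sub>v M \<Longrightarrow> v = 0\<^sub>v n"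
  shows "vec_space.rank M A = n"
proof -
  interpret V: vec_space "TYPE(complex)" M .
  \<comment> \<open>The rank is taken from the set of columns, so repetitions must be excluded:
    equal columns \<open>a\<close> and \<open>b\<close> would put the difference of two unit vectors
    in the kernel.\<close>
  have "distinct (cols A)"
  proof (rule ccontr)
    assume "\<not> distinct (cols A)"
    then obtain a b where ab: "a < n" "b < n" "a \<noteq> b" "col A a = col A b"
      using A by (auto simp: distinct_conv_nth)
    have "A $$ (t, a) = A $$ (t, b)" if "t < M" for t
      using arg_cong[OF ab(4), of "\<lambda>v. v $ t"] A ab(1,2) that by (simp add: col_def)
    then have "A *\<^sub>v (unit_vec n a - unit_vec n b) = 0\<^sub>v M"
      using A ab by (intro eq_vecI) (auto simp: scalar_prod_minus_distrib[of _ n])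
    then have "unit_vec n a - unit_vec n b = (0\<^sub>v n :: complex Matrix.vec)"
      by (intro inj) auto
    from arg_cong[OF this, of "\<lambda>v. v $ a"] ab show False by simp
  qed
  then show ?thesis
    using V.lin_indpt_full_rank[OF A] V.lin_depE[OF A] inj by blast
qed

lemma cdim_carrier: "cdim M (carrier_vec M) = M"
proof -
  interpret V: vec_space "TYPE(complex)" M .
  have eq: "(module_vec TYPE(complex) M)\<lparr>carrier := carrier_vec M\<rparr> = module_vec TYPE(complex) M"
    by (simp add: module_vec_def)
  show ?thesis unfolding cdim_def eq by (rule V.dim_is_n)
qed

lemma cspan_sum_eq_carrier:
  assumes B: "B \<subseteq> carrier_vec M" and C: "C \<subseteq> carrier_vec M"
    and unit: "\<And>t. t < M \<Longrightarrow> unit_vec M t \<in> cspan M (B \<union> C)"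
  shows "{u + v | u v. u \<in> cspan M B \<and> v \<in> cspan M C} = carrier_vec M"
proof -
  interpret V: vec_space "TYPE(complex)" M .
  have "V.span (set (unit_vecs M)) \<subseteq> V.span (B \<union> C)"
    using unit B C by (intro V.span_subsetI) (auto simp: cspan_def unit_vecs_def)
  moreover have "V.span (B \<union> C) \<subseteq> carrier_vec M"
    using V.span_is_subset2[of "B \<union> C"] B C by auto
  ultimately have "V.span (B \<union> C) = carrier_vec M"
    using V.span_unit_vecs_is_carrier by blast
  moreover have "V.span (B \<union> C) = {u + v | u v. u \<in> V.span B \<and> v \<in> V.span C}"
    using V.span_union_is_sum[of B C] B C by (auto simp: V.submodule_sum_def image_def)
  ultimately show ?thesis by (simp add: cspan_def)
qed

text \<open>Solve the equation for the unit vector. This is one elimination step, clearing the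
  component of \<open>u\<close> along an already available \<open>w\<close>.\<close>

lemma unit_vec_in_cspan:
  assumes B: "B \<subseteq> carrier_vec M" and u: "u \<in> cspan M B" and w: "w \<in> cspan M B"
    and c: "c \<noteq> 0" and eq: "u = a \<cdot>\<^sub>v w + c \<cdot>\<^sub>v unit_vec M t"
  shows "unit_vec M t \<in> cspan M B"
proof -
  interpret V: vec_space "TYPE(complex)" M .
  have car: "u \<in> carrier_vec M" "w \<in> carrier_vec M"
    using u w V.span_closed[of B] B by (auto simp: cspan_def)
  have "(- a) \<cdot>\<^sub>v w \<in> V.span B"
    using V.smult_in_span[OF B] w by (simp add: cspan_def)
  then have "u + (- a) \<cdot>\<^sub>v w \<in> V.span B"
    using V.span_add1[OF _ u[unfolded cspan_def]] B by simp
  then have "inverse c \<cdot>\<^sub>v (u + (- a) \<cdot>\<^sub>v w) \<in> V.span B"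
    by (rule V.smult_in_span[OF B])
  also have "inverse c \<cdot>\<^sub>v (u + (- a) \<cdot>\<^sub>v w) = unit_vec M t"
    using car c unfolding eq by (intro eq_vecI) (auto simp: field_simps)
  finally show ?thesis by (simp add: cspan_def)
qed

text \<open>For each pair of distinct symbol vectors the sum is a nonzero polynomial in
  \<open>z\<close>, with finitely many roots. Finitely many pairs exclude only finitely many
  \<open>z\<close>.\<close>

lemma exists_separating_powers:
  fixes X :: "complex Matrix.vec set"
  assumes X: "finite X" "X \<subseteq> carrier_vec (Suc l)"
  shows "\<exists>z. \<forall>x\<in>X. \<forall>x'\<in>X. x \<noteq> x' \<longrightarrow> (\<Sum>k\<le>l. (x $ k - x' $ k) * z ^ k) \<noteq> 0"
proof -
  have "finite {z. (\<Sum>k\<le>l. (x $ k - x' $ k) * z ^ k) = 0}" if "x \<in> X" "x' \<in> X" "x \<noteq> x'" for x x'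
  proof -
    have "x \<in> carrier_vec (Suc l)" "x' \<in> carrier_vec (Suc l)"
      using that X by auto
    then have "\<exists>k<Suc l. x $ k \<noteq> x' $ k"
      using eq_vecI[of x' x] that(3) by auto
    then obtain k where "k < Suc l" "x $ k \<noteq> x' $ k" by blast
    then show ?thesis
      unfolding polyfun_finite_roots by (intro exI[of _ k]) auto
  qed
  then have "finite (\<Union>x\<in>X. \<Union>x'\<in>X - {x}. {z. (\<Sum>k\<le>l. (x $ k - x' $ k) * z ^ k) = 0})"
    using X(1) by (intro finite_UN_I finite_Diff) auto
  moreover have "infinite (UNIV :: complex set)"
    by (rule infinite_UNIV_char_0)
  ultimately obtain z where "z \<notin> (\<Union>x\<in>X. \<Union>x'\<in>X - {x}. {z. (\<Sum>k\<le>l. (x $ k - x' $ k) * z ^ k) = 0})"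
    using ex_new_if_finite by blast
  then show ?thesis by blast
qed

subsection \<open>Precoders with reserved slots\<close>

text \<open>
  The row of slot \<open>i\<close> is Vandermonde, so that a single parameter \<open>z\<close> can be chosen to separate any
  finite alphabet; row \<open>K + k\<close> picks symbol \<open>k + 1\<close>.
\<close>

definition slot_precoder :: "nat \<Rightarrow> nat \<Rightarrow> complex \<Rightarrow> nat \<Rightarrow> complex mat" where
  "slot_precoder K l z i = Matrix.mat (l + K) (Suc l)
     (\<lambda>(t, k). if t = i then z ^ k else if K \<le> t \<and> k = Suc (t - K) then 1 else 0)"

lemma slot_precoder_carrier: "slot_precoder K l z i \<in> carrier_mat (l + K) (Suc l)"
  by (simp add: slot_precoder_def)

text \<open>A kernel vector has all entries of positive index zero by the shared rows
  \<open>K + k\<close>. The reserved row \<open>i\<close> then reduces to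
  \<open>z ^ 0 * v $ 0\<close>, which forces the first entry to vanish.\<close>

lemma rank_slot_precoder:
  assumes i: "i < K"
  shows "vec_space.rank (l + K) (slot_precoder K l z i) = Suc l"
proof (rule rank_eq_nc[OF slot_precoder_carrier])
  fix v :: "complex Matrix.vec" assume v: "v \<in> carrier_vec (Suc l)"
  assume eq: "slot_precoder K l z i *\<^sub>v v = 0\<^sub>v (l + K)"
  have row: "(\<Sum>k<Suc l. slot_precoder K l z i $$ (t, k) * v $ k) = 0" if "t < l + K" for t
    using arg_cong[OF eq, of "\<lambda>u. u $ t"] that v slot_precoder_carrier[of K l z i]
    by (simp add: scalar_prod_def atLeast0LessThan del: sum.lessThan_Suc)
  have pos: "v $ Suc k = 0" if k: "k < l" for k
  proof -
    have "(\<Sum>k'<Suc l. slot_precoder K l z i $$ (K + k, k') * v $ k')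
        = (\<Sum>k'<Suc l. if k' = Suc k then v $ k' else 0)"
      using i k by (intro sum.cong refl) (auto simp: slot_precoder_def)
    then show ?thesis
      using row[of "K + k"] k by (simp del: sum.lessThan_Suc)
  qed
  have "(\<Sum>k'<Suc l. slot_precoder K l z i $$ (i, k') * v $ k') = v $ 0"
    using i pos by (simp add: sum.lessThan_Suc_shift slot_precoder_def del: sum.lessThan_Suc)
  then have "v $ 0 = 0"
    using row[of i] i by (simp del: sum.lessThan_Suc)
  then show "v = 0\<^sub>v (Suc l)"
    using v pos by (intro eq_vecI) (auto simp: less_Suc_eq_0_disj)
qed

section \<open>Received signals under the slot precoders\<close>

context
  fixes K l :: nat and \<eta> :: "nat \<Rightarrow> nat \<Rightarrow> nat \<Rightarrow> complex" and H :: "nat \<Rightarrow> nat \<Rightarrow> complex mat"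
    and z :: "nat \<Rightarrow> complex" and Q :: "nat \<Rightarrow> complex mat"
  assumes H: "\<And>i j. H i j = mat_diag (l + K) (\<eta> i j)"
    and \<eta>: "\<And>i j t. i < K \<Longrightarrow> j < K \<Longrightarrow> t < l + K \<Longrightarrow> \<eta> i j t \<noteq> 0"
    and Q: "\<And>j. Q j = slot_precoder K l (z j) j"
begin

text \<open>A diagonal channel only scales rows, so the slots in which a transmitter is silent stay
  empty at every receiver.\<close>

lemma received_eq: "H i j * Q j = Matrix.mat (l + K) (Suc l)
   (\<lambda>(t, k). \<eta> i j t * (if t = j then z j ^ k else if K \<le> t \<and> k = Suc (t - K) then 1 else 0))"
  unfolding H Q mat_diag_mult_left[OF slot_precoder_carrier]
  by (intro eq_matI) (auto simp: slot_precoder_def)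

lemma received_carrier: "H i j * Q j \<in> carrier_mat (l + K) (Suc l)"
  by (simp add: received_eq)

lemma received_cols: "set (cols (H i j * Q j)) \<subseteq> carrier_vec (l + K)"
  by (metis carrier_matD(1) cols_dim received_carrier)

lemma received_col: "k < Suc l \<Longrightarrow> col (H i j * Q j) k \<in> set (cols (H i j * Q j))"
  by (metis carrier_matD(2) cols_length cols_nth nth_mem received_carrier)

text \<open>Column 0 is a nonzero multiple of the unit vector of slot \<open>j\<close>. A later
  column is a combination of that vector and one shared slot's unit vector with nonzero coefficient,
  so the former can be eliminated.\<close>

lemma unit_vec_in_received_span:
  assumes ij: "i < K" "j < K" and B: "set (cols (H i j * Q j)) \<subseteq> B" "B \<subseteq> carrier_vec (l + K)"
    and t: "t = j \<or> K \<le> t" "t < l + K"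
  shows "unit_vec (l + K) t \<in> cspan (l + K) B"
proof -
  interpret V: vec_space "TYPE(complex)" "l + K" .
  have "B \<subseteq> cspan (l + K) B"
    using V.in_own_span[of B] B by (simp add: cspan_def)
  then have col: "col (H i j * Q j) k \<in> cspan (l + K) B" if "k < Suc l" for k
    using B(1) received_col[OF that, of i j] by blast
  have e: "unit_vec (l + K) j \<in> cspan (l + K) B"
  proof (rule unit_vec_in_cspan[OF B(2) col[of 0] col[of 0]])
    show "\<eta> i j j \<noteq> 0" using \<eta> ij by simp
    show "col (H i j * Q j) 0 = 0 \<cdot>\<^sub>v col (H i j * Q j) 0 + \<eta> i j j \<cdot>\<^sub>v unit_vec (l + K) j"
      using ij by (intro eq_vecI) (auto simp: received_eq)
  qed simp_all
  show ?thesis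
  proof (cases "t = j")
    case False
    then have t': "K \<le> t" "t < l + K" using t by auto
    show ?thesis
    proof (rule unit_vec_in_cspan[OF B(2) col[of "Suc (t - K)"] e])
      show "\<eta> i j t \<noteq> 0" using \<eta> ij t' by simp
      show "col (H i j * Q j) (Suc (t - K))
          = (\<eta> i j j * z j ^ Suc (t - K)) \<cdot>\<^sub>v unit_vec (l + K) j + \<eta> i j t \<cdot>\<^sub>v unit_vec (l + K) t"
        using ij t' by (intro eq_vecI) (auto simp: received_eq)
    qed (use t' in simp)
  qed (use e in simp)
qed

text \<open>All interference vanishes in slot \<open>i\<close>, so it misses a dimension. The unit
  vector of another reserved slot \<open>t\<close> comes from interferer \<open>t\<close>; those of
  slot \<open>i\<close> and of the shared slots come from the desired signal.\<close>

lemma FIA_slot_precoder: "FIA K (l + K) H Q"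
  unfolding FIA_def
proof (intro allI impI conjI)
  fix i assume i: "i < K"
  let ?S = "set (cols (H i i * Q i))" and ?I = "\<Union>j\<in>{..<K} - {i}. set (cols (H i j * Q j))"
  have S: "?S \<subseteq> carrier_vec (l + K)" and I: "?I \<subseteq> carrier_vec (l + K)"
    using received_cols by blast+
  show "cdim (l + K) (interference_space K (l + K) H Q i) < l + K"
    unfolding interference_space_def
  proof (rule cdim_cspan_less[OF _ I])
    fix b assume "b \<in> ?I"
    then obtain j where "j \<noteq> i" and b: "b \<in> set (cols (H i j * Q j))" by blast
    moreover obtain k where "k < Suc l" "b = col (H i j * Q j) k"
      using b received_carrier[of i j] by (metis carrier_matD(2) cols_length cols_nth in_set_conv_nth)
    ultimately show "b $ i = 0"
      using i by (simp add: received_eq)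
  qed (use i in auto)
  have "unit_vec (l + K) t \<in> cspan (l + K) (?S \<union> ?I)" if t: "t < l + K" for t
  proof (cases "t < K \<and> t \<noteq> i")
    case True
    then show ?thesis
      using i t S I by (intro unit_vec_in_received_span[of i t]) auto
  next
    case False
    then show ?thesis
      using i t S I by (intro unit_vec_in_received_span[of i i]) auto
  qed
  then show "cdim (l + K) {u + v |u v. u \<in> signal_space (l + K) H Q i
      \<and> v \<in> interference_space K (l + K) H Q i} = l + K"
    unfolding signal_space_def interference_space_def
    by (simp add: cspan_sum_eq_carrier[OF S I] cdim_carrier)
qed

lemma slot_precoder_achieves:
  assumes alphabets: "\<And>j m. j < K \<Longrightarrow> 1 \<le> m \<Longrightarrow> labelled_alphabet m (X j m) (lab j m)"
    and z: "\<And>i x x'. i < K \<Longrightarrow> x \<in> X i (Suc l) \<Longrightarrow> x' \<in> X i (Suc l) \<Longrightarrow> x \<noteq> x' \<Longrightarrow>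
      (\<Sum>k\<le>l. (x $ k - x' $ k) * z i ^ k) \<noteq> 0"
  shows "achieves_without_floor K (l + K) H X lab (\<lambda>_. Suc l) Q"
  unfolding achieves_without_floor_def
proof (intro conjI allI impI)
  show "valid_precoders K (l + K) (\<lambda>_. Suc l) Q"
    by (simp add: valid_precoders_def Q slot_precoder_carrier rank_slot_precoder)
  show "FIA K (l + K) H Q" by (rule FIA_slot_precoder)
next
  fix i assume i: "i < K"
  have X: "finite (X i (Suc l))" "X i (Suc l) \<subseteq> carrier_vec (Suc l)"
    using alphabets[OF i, of "Suc l"] by (auto simp: labelled_alphabet_def)
  show "((\<lambda>s. BER (l + K) (H i i * Q i) (noise_cov K (l + K) H Q i s) (X i (Suc l)) (lab i (Suc l)))
      \<longlongrightarrow> 0) (at_right 0)"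
  proof (rule BER_tendsto_0[OF X received_carrier, of i])
    show "i < l + K" using i by simp
    show "H i j \<in> carrier_mat (l + K) (l + K)" for j
      by (simp add: H mat_diag_def)
    show "Q j \<in> carrier_mat (l + K) (Suc l)" for j
      by (simp add: Q slot_precoder_carrier)
    show "(H i j * Q j) $$ (i, k) = 0" if "j \<noteq> i" "k < Suc l" for j k
      using i that by (simp add: received_eq)
    fix x x' assume x: "x \<in> X i (Suc l)" "x' \<in> X i (Suc l)" "x \<noteq> x'"
    have xc: "x \<in> carrier_vec (Suc l)" "x' \<in> carrier_vec (Suc l)"
      using x X by auto
    \<comment> \<open>Row \<open>i\<close> of the effective channel is \<open>\<eta> i i i\<close>
      times the powers of \<open>z i\<close>, so this coordinate evaluates the difference polynomial
      at \<open>z i\<close>.\<close>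
    have "((H i i * Q i) *\<^sub>v x - (H i i * Q i) *\<^sub>v x') $ i = \<eta> i i i * (\<Sum>k\<le>l. (x $ k - x' $ k) * z i ^ k)"
      using xc i
      by (simp add: received_eq scalar_prod_def atLeast0LessThan lessThan_Suc_atMost
          sum_subtractf[symmetric] sum_distrib_left algebra_simps del: sum.atMost_Suc)
    then show "((H i i * Q i) *\<^sub>v x - (H i i * Q i) *\<^sub>v x') $ i \<noteq> 0"
      using \<eta>[OF i i, of i] i z[OF i x] by simp
  qed
qed

end

section \<open>Existence of precoders and the almost sure statement\<close>

lemma ex_precoders_achieving:
  assumes H: "\<And>i j. H i j = mat_diag (l + K) (\<eta> i j)"
    and \<eta>: "\<And>i j t. i < K \<Longrightarrow> j < K \<Longrightarrow> t < l + K \<Longrightarrow> \<eta> i j t \<noteq> 0"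
    and alphabets: "\<And>j m. j < K \<Longrightarrow> 1 \<le> m \<Longrightarrow> labelled_alphabet m (X j m) (lab j m)"
  shows "\<exists>Q. achieves_without_floor K (l + K) H X lab (\<lambda>_. Suc l) Q"
proof -
  \<comment> \<open>The parameters \<open>z\<close> are chosen from the alphabets alone,
    independently of the channel coefficients.\<close>
  have "\<exists>z. \<forall>x\<in>X i (Suc l). \<forall>x'\<in>X i (Suc l). x \<noteq> x' \<longrightarrow> (\<Sum>k\<le>l. (x $ k - x' $ k) * z ^ k) \<noteq> 0"
    if "i < K" for i
    using alphabets[OF that, of "Suc l"]
    by (intro exists_separating_powers) (auto simp: labelled_alphabet_def)
  then obtain z where "\<And>i x x'. i < K \<Longrightarrow> x \<in> X i (Suc l) \<Longrightarrow> x' \<in> X i (Suc l) \<Longrightarrow> x \<noteq> x' \<Longrightarrow>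
      (\<Sum>k\<le>l. (x $ k - x' $ k) * z i ^ k) \<noteq> 0"
    by metis
  then have "achieves_without_floor K (l + K) H X lab (\<lambda>_. Suc l) (\<lambda>j. slot_precoder K l (z j) j)"
    by (intro slot_precoder_achieves[OF H \<eta> refl alphabets])
  then show ?thesis by blast
qed

lemma (in prob_space) AE_nonzero_if_distr_atomless:
  fixes f :: "'a \<Rightarrow> complex"
  assumes f: "random_variable borel f" and D: "distr M borel f = D" and cont: "emeasure D {0} = 0"
  shows "AE \<omega> in M. f \<omega> \<noteq> 0"
proof -
  have "AE w in distr M borel f. w \<noteq> 0"
    using cont unfolding D[symmetric] by (intro AE_I[of _ _ "{0}"]) auto
  then show ?thesis
    using f by (subst (asm) AE_distr_iff) auto
qed

theorem theorem4:
  fixes K :: nat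
    and P :: "'w measure"
    and D :: "complex measure"
    and h :: "nat \<Rightarrow> nat \<Rightarrow> nat \<Rightarrow> nat \<Rightarrow> 'w \<Rightarrow> complex"
    and H :: "'w \<Rightarrow> nat \<Rightarrow> nat \<Rightarrow> nat \<Rightarrow> complex mat"
    and X :: "nat \<Rightarrow> nat \<Rightarrow> complex vec set"
    and lab :: "nat \<Rightarrow> nat \<Rightarrow> complex vec \<Rightarrow> bool list"
  assumes K: "1 \<le> K"
    and P: "prob_space P"
    and indep: "\<And>M. prob_space.indep_vars P (\<lambda>_. borel) (\<lambda>(i, j, t). h M i j t)
                       ({..<K} \<times> {..<K} \<times> {..<M})"
    and ident: "\<And>M i j t. i < K \<Longrightarrow> j < K \<Longrightarrow> t < M \<Longrightarrow> distr P borel (h M i j t) = D"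
    and cont: "\<And>z. emeasure D {z} = 0"
    and H: "\<And>\<omega> M i j. H \<omega> M i j = mat_diag M (\<lambda>t. h M i j t \<omega>)"
    and alphabets: "\<And>j m. j < K \<Longrightarrow> 1 \<le> m \<Longrightarrow> labelled_alphabet m (X j m) (lab j m)"
  shows "(\<forall>M n Q. 1 \<le> M \<longrightarrow> valid_precoders K M n Q \<longrightarrow> (\<forall>j<K. SpAC M (n j) \<le> 1)) \<and>
         (AE \<omega> in P. \<exists>(M :: nat \<Rightarrow> nat) (n :: nat \<Rightarrow> nat \<Rightarrow> nat) (Q :: nat \<Rightarrow> nat \<Rightarrow> complex mat).
            filterlim M at_top sequentially \<and>
            (\<forall>l. achieves_without_floor K (M l) (H \<omega> (M l)) X lab (n l) (Q l)) \<and>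
            (\<forall>j<K. (\<lambda>l. SpAC (M l) (n l j)) \<longlonglongrightarrow> 1))"
proof (intro conjI allI impI)
  fix M n Q j assume M: "1 \<le> M" and Q: "valid_precoders K M n Q" and j: "j < K"
  have "Q j \<in> carrier_mat M (n j)" "vec_space.rank M (Q j) = n j"
    using Q j by (auto simp: valid_precoders_def)
  \<comment> \<open>Full column rank bounds the number of streams by the number of rows, which is
    the entire converse.\<close>
  then have "n j \<le> M" using rank_le_nr by metis
  then show "SpAC M (n j) \<le> 1"
    using M by (simp add: SpAC_def divide_le_eq_1)
next
  interpret P: prob_space P by (rule P)
  have "AE \<omega> in P. h M i j t \<omega> \<noteq> 0" if "i < K" "j < K" "t < M" for M i j t
  proof (rule P.AE_nonzero_if_distr_atomless)
    \<comment> \<open>Measurability of each coefficient is part of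
      \<open>indep_vars\<close>.\<close>
    show "h M i j t \<in> borel_measurable P"
      using bspec[OF conjunct1[OF indep[of M, unfolded P.indep_vars_def2]], of "(i, j, t)"] that by simp
  qed (use ident that cont in auto)
  \<comment> \<open>The indices are countable, so one null set serves all extension factors at
    once.\<close>
  then have "AE \<omega> in P. \<forall>M i j t. i < K \<longrightarrow> j < K \<longrightarrow> t < M \<longrightarrow> h M i j t \<omega> \<noteq> 0"
    by (simp add: AE_all_countable)
  then show "AE \<omega> in P. \<exists>(M :: nat \<Rightarrow> nat) (n :: nat \<Rightarrow> nat \<Rightarrow> nat) (Q :: nat \<Rightarrow> nat \<Rightarrow> complex mat).
            filterlim M at_top sequentially \<and>
            (\<forall>l. achieves_without_floor K (M l) (H \<omega> (M l)) X lab (n l) (Q l)) \<and>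
            (\<forall>j<K. (\<lambda>l. SpAC (M l) (n l j)) \<longlonglongrightarrow> 1)"
  proof (rule AE_mp, intro AE_I2 impI)
    fix \<omega> assume nz: "\<forall>M i j t. i < K \<longrightarrow> j < K \<longrightarrow> t < M \<longrightarrow> h M i j t \<omega> \<noteq> 0"
    have "\<exists>Q. achieves_without_floor K (l + K) (H \<omega> (l + K)) X lab (\<lambda>_. Suc l) Q" for l
      using nz by (intro ex_precoders_achieving[OF H _ alphabets]) auto
    then obtain Q where "\<And>l. achieves_without_floor K (l + K) (H \<omega> (l + K)) X lab (\<lambda>_. Suc l) (Q l)"
      by metis
    moreover have "filterlim (\<lambda>l. l + K) at_top sequentially"
      by (rule filterlim_add_const_nat_at_top)
    \<comment> \<open>The ratio is \<open>(l + 1) / (l + K)\<close>: the loss from reserving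
      \<open>K\<close> slots is negligible for large \<open>l\<close>.\<close>
    moreover have "(\<lambda>l. SpAC (l + K) (Suc l)) \<longlonglongrightarrow> 1"
      unfolding SpAC_def by real_asymp
    ultimately show "\<exists>(M :: nat \<Rightarrow> nat) (n :: nat \<Rightarrow> nat \<Rightarrow> nat) (Q :: nat \<Rightarrow> nat \<Rightarrow> complex mat).
            filterlim M at_top sequentially \<and>
            (\<forall>l. achieves_without_floor K (M l) (H \<omega> (M l)) X lab (n l) (Q l)) \<and>
            (\<forall>j<K. (\<lambda>l. SpAC (M l) (n l j)) \<longlonglongrightarrow> 1)"
      by (intro exI[of _ "\<lambda>l. l + K"] exI[of _ "\<lambda>l _. Suc l"] exI[of _ Q]) auto
  qed
qed

end
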